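(* Let $d\ge 1$ and $N \ge 1$ be integers. For every $N$-element point set $\mathcal{P}$ in $[0,1)^d$ we have $$L_{2,N}^{\mathrm{extr}}(\mathcal{P}) \le L_{2,N}(\mathcal{P}).$$
   Context: Let $\mathcal{P}=\{\boldsymbol{x}_0,\dots,\boldsymbol{x}_{N-1}\}$ be an $N$-element point set in $[0,1)^d$. For measurable $B\subseteq[0,1]^d$ let $A(B,\mathcal{P})=|\{n\in\{0,\dots,N-1\}: \boldsymbol{x}_n\in B\}|$, and let $\lambda$ be Lebesgue measure. For $\boldsymbol{x}=(x_1,\dots,x_d)$ and $\boldsymbol{y}=(y_1,\dots,y_d)$ in $[0,1]^d$, $\boldsymbol{x}\le\boldsymbol{y}$ means $x_i\le y_i$ for all $i$, and then $[\boldsymbol{x},\boldsymbol{y})=\prod_{i=1}^d[x_i,y_i)$. Standard $L_2$ discrepancy: $$L_{2,N}(\mathcal{P})=\left(\int_{[0,1]^d}|A([\boldsymbol{0},\boldsymbol{t}),\mathcal{P})-N\lambda([\boldsymbol{0},\boldsymbol{t}))|^2\,\mathrm{d}\boldsymbol{t}\right)^{1/2}.$$ Extreme $L_2$ discrepancy: $$L_{2,N}^{\mathrm{extr}}(\mathcal{P})=\left(\int_{[0,1]^d}\int_{[0,1]^d,\ \boldsymbol{x}\le\boldsymbol{y}}|A([\boldsymbol{x},\boldsymbol{y}),\mathcal{P})-N\lambda([\boldsymbol{x},\boldsymbol{y}))|^2\,\mathrm{d}\boldsymbol{x}\,\mathrm{d}\boldsymbol{y}\right)^{1/2}.$$ 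*)

theory Defs
  imports "HOL-Analysis.Analysis"
begin

(* The order on real^'d is componentwise, but its strict part < is not componentwise strict,
   so the half-open box is written out by coordinates rather than as {x..<y}. *)
definition half_open_box :: "real ^ 'd \<Rightarrow> real ^ 'd \<Rightarrow> (real ^ 'd) set" where
  "half_open_box x y = {z. \<forall>i. x $ i \<le> z $ i \<and> z $ i < y $ i}"

(* Since P is a set, its elements are pairwise distinct, and counting points of P in B is
   the same as counting indices n with x_n in B. *)
definition point_count :: "(real ^ 'd) set \<Rightarrow> (real ^ 'd) set \<Rightarrow> nat" where
  "point_count B P = card {p \<in> P. p \<in> B}"

definition L2_discrepancy :: "nat \<Rightarrow> (real ^ 'd) set \<Rightarrow> real" where
  "L2_discrepancy N P =
     sqrt (LINT t:cbox 0 1|lborel.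
       \<bar>real (point_count (half_open_box 0 t) P) - real N * measure lborel (half_open_box 0 t)\<bar>\<^sup>2)"

definition extreme_L2_discrepancy :: "nat \<Rightarrow> (real ^ 'd) set \<Rightarrow> real" where
  "extreme_L2_discrepancy N P =
     sqrt (LINT y:cbox 0 1|lborel. (LINT x:{x \<in> cbox 0 1. x \<le> y}|lborel.
       \<bar>real (point_count (half_open_box x y) P) - real N * measure lborel (half_open_box x y)\<bar>\<^sup>2))"

end

theory Submission
  imports Defs "HOL-Probability.Probability_Measure"
begin

(* With one term for every point of P and one for Lebesgue measure, the local discrepancy is
   sum_k c_k prod_i a_ki(t_i), so the squared standard and extreme discrepancies are the quadratic
   forms in c whose kernels are the products over i of the inner products (a_ki, a_li) in L2[0,1]
   and of the covariances of a_ki and a_li respectively: in one dimension the integral over x <= y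
   is half the integral over the square, by symmetry. Inner product and covariance differ by the
   rank one term m_ki m_li of the means. Expanding the product over i, the difference of the
   kernels is a sum of products of Gram kernels, and each of these has a nonnegative quadratic
   form because it is the integral of a square. *)

section \<open>Integrals of products of one-variable functions over the space and the unit
  cube\<close>

lemma prod_Basis_vec:
  fixes f :: "'d::finite \<Rightarrow> real \<Rightarrow> real" and x :: "real ^ 'd"
  shows "(\<Prod>b\<in>Basis. f (axis_index b) (x \<bullet> b)) = (\<Prod>i\<in>UNIV. f i (x $ i))"
proof -
  have "bij_betw (\<lambda>i::'d. axis i (1::real)) UNIV Basis"
    by (auto simp: bij_betw_def inj_on_def axis_eq_axis Basis_vec_def)
  then show ?thesis
    by (simp add: prod.reindex_bij_betw[symmetric] inner_axis)
qed

text \<open>Fubini: \<open>lborel\<close> is the image of a product of copies of real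
  \<open>lborel\<close> indexed by \<open>Basis\<close>, and after pulling back along that map each
  factor depends on a single coordinate. With \<open>has_bochner_integral\<close>, integrability and
  value pass together through the finite sums below.\<close>

lemma has_bochner_integral_lborel_prod:
  fixes f :: "'d::finite \<Rightarrow> real \<Rightarrow> real"
  assumes f: "\<And>i. integrable lborel (f i)"
  shows "has_bochner_integral lborel (\<lambda>x::real ^ 'd. \<Prod>i\<in>UNIV. f i (x $ i)) (\<Prod>i\<in>UNIV. \<integral>x. f i x \<partial>lborel)"
proof -
  interpret product_sigma_finite "\<lambda>_::real ^ 'd. lborel :: real measure"
    by standard
  have [measurable]: "f i \<in> borel_measurable borel" for i
    using borel_measurable_integrable[OF f] by simp
  let ?F = "\<lambda>x::real ^ 'd. \<Prod>b\<in>Basis. f (axis_index b) (x \<bullet> b)"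
  let ?h = "\<lambda>g. \<Sum>b\<in>Basis. g b *\<^sub>R (b :: real ^ 'd)"
  have h: "?F (?h g) = (\<Prod>b\<in>Basis. f (axis_index b) (g b))" for g
    by (intro prod.cong refl) simp
  have F: "?F \<in> borel_measurable borel" and hm: "?h \<in> measurable (\<Pi>\<^sub>M b\<in>Basis. lborel) borel"
    by measurable
  have "integrable (\<Pi>\<^sub>M b\<in>Basis. lborel) (\<lambda>g. ?F (?h g))"
    unfolding h by (rule product_integrable_prod) (use f in auto)
  moreover have "(\<integral>g. ?F (?h g) \<partial>(\<Pi>\<^sub>M b\<in>Basis. lborel)) = (\<Prod>b\<in>(Basis :: (real ^ 'd) set). \<integral>x. f (axis_index b) x \<partial>lborel)"
    unfolding h by (rule product_integral_prod) (use f in auto)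
  \<comment> \<open>Factors that ignore their argument turn \<open>prod_Basis_vec\<close> into a
    pure reindexing from basis vectors to coordinates; the point 0 is arbitrary.\<close>
  moreover have "\<dots> = (\<Prod>i\<in>UNIV. \<integral>x. f i x \<partial>lborel)"
    using prod_Basis_vec[of "\<lambda>i _. \<integral>x. f i x \<partial>lborel" 0] by simp
  ultimately have "has_bochner_integral lborel ?F (\<Prod>i\<in>UNIV. \<integral>x. f i x \<partial>lborel)"
    unfolding has_bochner_integral_iff
    by (subst (1 2) lborel_eq) (simp add: integrable_distr_eq[OF hm F] integral_distr[OF hm F])
  then show ?thesis
    by (simp add: prod_Basis_vec)
qed

abbreviation unit_interval :: "real measure" where
  "unit_interval \<equiv> restrict_space lborel {0..1}"

abbreviation unit_cube :: "(real ^ 'd) measure" where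
  "unit_cube \<equiv> restrict_space lborel (cbox 0 1)"

text \<open>Total mass 1 makes bounded measurable functions integrable and lets a constant integrate
  to itself, as centring at the mean requires.\<close>

lemma prob_space_unit_interval: "prob_space unit_interval"
  by (rule prob_spaceI) (simp add: emeasure_restrict_space space_restrict_space)

lemma measure_unit_interval [simp]: "measure unit_interval {0..1} = 1"
  using prob_space.prob_space[OF prob_space_unit_interval] by (simp add: space_restrict_space)

text \<open>The indicator of the cube is the product of the indicators of [0,1] in each coordinate,
  so it can be absorbed into the factors.\<close>

lemma has_bochner_integral_unit_cube_prod:
  fixes f :: "'d::finite \<Rightarrow> real \<Rightarrow> real"
  assumes f: "\<And>i. integrable unit_interval (f i)"
  shows "has_bochner_integral unit_cube (\<lambda>x::real ^ 'd. \<Prod>i\<in>UNIV. f i (x $ i)) (\<Prod>i\<in>UNIV. \<integral>x. f i x \<partial>unit_interval)"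
proof -
  have "indicator (cbox 0 1) x *\<^sub>R (\<Prod>i\<in>UNIV. f i (x $ i)) = (\<Prod>i\<in>UNIV. indicator {0..1} (x $ i) * f i (x $ i))"
    for x :: "real ^ 'd"
  proof -
    have "(\<Prod>i\<in>UNIV. indicator {0..1} (x $ i)) = (indicator (cbox 0 1) x :: real)"
      by (auto simp: indicator_def mem_box_cart prod_zero_iff)
    then show ?thesis
      by (simp add: prod.distrib)
  qed
  then show ?thesis
    using f has_bochner_integral_lborel_prod[of "\<lambda>i x. indicator {0..1} x * f i x"]
    by (simp add: has_bochner_integral_restrict_space integral_restrict_space integrable_restrict_space)
qed

section \<open>One dimension: increments over ordered pairs and covariance\<close>

lemma integrable_unit_interval_bounded:
  fixes f :: "real \<Rightarrow> real"
  assumes "f \<in> borel_measurable borel" and "\<And>x. x \<in> {0..1} \<Longrightarrow> \<bar>f x\<bar> \<le> C"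
  shows "integrable unit_interval f"
proof -
  interpret prob_space unit_interval
    by (rule prob_space_unit_interval)
  show ?thesis
    by (rule integrable_const_bound[of _ C]) 
      (use assms in \<open>auto simp: space_restrict_space intro!: AE_I2 measurable_restrict_space1\<close>)
qed

text \<open>Reflection in the diagonal exchanges the two triangles of the square and preserves
  \<open>F\<close>, so each carries half of the integral. Both triangles contain the diagonal, which
  is harmless because \<open>F\<close> vanishes there.\<close>

lemma iterated_integral_half_symmetric:
  fixes F :: "real \<Rightarrow> real \<Rightarrow> real"
  assumes M: "sigma_finite_measure M" and int: "integrable (M \<Otimes>\<^sub>M M) (\<lambda>(y, x). F y x)"
    and half: "integrable (M \<Otimes>\<^sub>M M) (\<lambda>(y, x). if x \<le> y then F y x else 0)"
    and sym: "\<And>x y. F x y = F y x" and diag: "\<And>x. F x x = 0"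
  shows "2 * (\<integral>y. (\<integral>x. (if x \<le> y then F y x else 0) \<partial>M) \<partial>M) = (\<integral>y. (\<integral>x. F y x \<partial>M) \<partial>M)"
proof -
  interpret M: sigma_finite_measure M by fact
  interpret pair_sigma_finite M M ..
  let ?H = "\<lambda>(y, x). if x \<le> y then F y x else 0"
  have swap: "integrable (M \<Otimes>\<^sub>M M) (\<lambda>(y, x). ?H (x, y))"
    using integrable_product_swap[OF half] .
  have "(\<integral>y. (\<integral>x. F y x \<partial>M) \<partial>M) = (\<integral>z. (case z of (y, x) \<Rightarrow> F y x) \<partial>(M \<Otimes>\<^sub>M M))"
    using integral_fst'[OF int] by simp
  also have "\<dots> = (\<integral>z. ?H z + (case z of (y, x) \<Rightarrow> ?H (x, y)) \<partial>(M \<Otimes>\<^sub>M M))"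
    by (intro Bochner_Integration.integral_cong) (auto simp: sym diag dest: antisym)
  also have "\<dots> = 2 * (\<integral>z. ?H z \<partial>(M \<Otimes>\<^sub>M M))"
    using Bochner_Integration.integral_add[OF half swap]
      integral_product_swap[OF borel_measurable_integrable[OF half]] by simp
  also have "\<dots> = 2 * (\<integral>y. (\<integral>x. (if x \<le> y then F y x else 0) \<partial>M) \<partial>M)"
    using integral_fst'[OF half] by simp
  finally show ?thesis by simp
qed

text \<open>Over the whole square, the products of values at the same point contribute the integral
  of \<open>a * b\<close> twice and the two cross terms each subtract the product of the means. This
  is twice the covariance, and the triangle x \<le> y carries half. The two integrability claims are
  what the coordinatewise factorization in higher dimension asks for.\<close>

lemma covariance_eq_integral_increments:
  fixes a b :: "real \<Rightarrow> real"
  assumes [measurable]: "a \<in> borel_measurable borel" "b \<in> borel_measurable borel"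
    and bounded: "\<And>x. x \<in> {0..1} \<Longrightarrow> \<bar>a x\<bar> \<le> C" "\<And>x. x \<in> {0..1} \<Longrightarrow> \<bar>b x\<bar> \<le> C"
  defines "F \<equiv> \<lambda>y x. if x \<le> y then (a y - a x) * (b y - b x) else 0"
  shows "\<And>y. y \<in> {0..1} \<Longrightarrow> integrable unit_interval (F y)"
    and "integrable unit_interval (\<lambda>y. \<integral>x. F y x \<partial>unit_interval)"
    and "(\<integral>y. (\<integral>x. F y x \<partial>unit_interval) \<partial>unit_interval) =
      (\<integral>x. a x * b x \<partial>unit_interval) - (\<integral>x. a x \<partial>unit_interval) * (\<integral>x. b x \<partial>unit_interval)"
proof -
  interpret U: prob_space unit_interval
    by (rule prob_space_unit_interval)
  interpret pair_prob_space unit_interval unit_interval ..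
  let ?U2 = "unit_interval \<Otimes>\<^sub>M unit_interval"
  let ?G = "\<lambda>y x. (a y - a x) * (b y - b x)"
  have C: "0 \<le> C"
    using bounded(1)[of 0] by simp
  have G_bound: "\<bar>?G y x\<bar> \<le> (2 * C) * (2 * C)" if "x \<in> {0..1}" "y \<in> {0..1}" for x y
    unfolding abs_mult using bounded[OF that(1)] bounded[OF that(2)] C
    by (intro mult_mono) auto
  then have F_bound: "\<bar>F y x\<bar> \<le> (2 * C) * (2 * C)" if "x \<in> {0..1}" "y \<in> {0..1}" for x y
    using that C by (auto simp: F_def)
  \<comment> \<open>Viewing the coordinates of the square as Borel real functions gives
    measurability of \<open>a\<close> and \<open>b\<close> composed with them and of the triangle x
    \<le> y.\<close>
  have id [measurable]: "(\<lambda>x. x) \<in> borel_measurable unit_interval"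
    by (intro measurable_restrict_space1) simp
  have [measurable]: "fst \<in> borel_measurable ?U2" "snd \<in> borel_measurable ?U2"
    using measurable_compose[OF measurable_fst id] measurable_compose[OF measurable_snd id] by simp_all
  show F_int: "integrable unit_interval (F y)" if "y \<in> {0..1}" for y
  proof (rule integrable_unit_interval_bounded)
    show "F y \<in> borel_measurable borel"
      unfolding F_def by measurable
    show "\<bar>F y x\<bar> \<le> (2 * C) * (2 * C)" if "x \<in> {0..1}" for x
      using F_bound that \<open>y \<in> {0..1}\<close> by blast
  qed
  have G2: "integrable ?U2 (\<lambda>(y, x). ?G y x)"
  proof (rule integrable_const_bound[of _ "(2 * C) * (2 * C)"])
    show "AE z in ?U2. norm (case z of (y, x) \<Rightarrow> ?G y x) \<le> (2 * C) * (2 * C)"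
      using G_bound by (auto simp: space_pair_measure space_restrict_space intro!: AE_I2)
  qed (unfold case_prod_beta, measurable)
  have F2: "integrable ?U2 (\<lambda>(y, x). F y x)"
  proof (rule integrable_const_bound[of _ "(2 * C) * (2 * C)"])
    show "AE z in ?U2. norm (case z of (y, x) \<Rightarrow> F y x) \<le> (2 * C) * (2 * C)"
      using F_bound by (auto simp: space_pair_measure space_restrict_space intro!: AE_I2)
  qed (unfold F_def case_prod_beta, measurable)
  show "integrable unit_interval (\<lambda>y. \<integral>x. F y x \<partial>unit_interval)"
    using integrable_fst'[OF F2] by simp
  have a: "integrable unit_interval a" and b: "integrable unit_interval b"
    using bounded by (auto intro!: integrable_unit_interval_bounded[of _ C])
  have ab: "integrable unit_interval (\<lambda>x. a x * b x)"
  proof (rule integrable_unit_interval_bounded)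
    show "\<bar>a x * b x\<bar> \<le> C * C" if "x \<in> {0..1}" for x
      unfolding abs_mult using bounded that C by (intro mult_mono) auto
  qed measurable
  have G_inner: "(\<integral>x. ?G y x \<partial>unit_interval) = a y * b y - a y * (\<integral>x. b x \<partial>unit_interval)
      - b y * (\<integral>x. a x \<partial>unit_interval) + (\<integral>x. a x * b x \<partial>unit_interval)" for y
  proof -
    have "?G y x = a y * b y - a y * b x - b y * a x + a x * b x" for x
      by (simp add: algebra_simps)
    then show ?thesis
      using a b ab by simp
  qed
  have "2 * (\<integral>y. (\<integral>x. F y x \<partial>unit_interval) \<partial>unit_interval) = (\<integral>y. (\<integral>x. ?G y x \<partial>unit_interval) \<partial>unit_interval)"
    unfolding F_def
    by (rule iterated_integral_half_symmetric)
      (use G2 F2 in \<open>auto simp: F_def algebra_simps U.sigma_finite_measure_axioms\<close>)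
  also have "\<dots> = 2 * ((\<integral>x. a x * b x \<partial>unit_interval) - (\<integral>x. a x \<partial>unit_interval) * (\<integral>x. b x \<partial>unit_interval))"
    unfolding G_inner using a b ab by simp
  finally show "(\<integral>y. (\<integral>x. F y x \<partial>unit_interval) \<partial>unit_interval) =
      (\<integral>x. a x * b x \<partial>unit_interval) - (\<integral>x. a x \<partial>unit_interval) * (\<integral>x. b x \<partial>unit_interval)"
    by simp
qed

section \<open>Quadratic forms with product kernels\<close>

lemma square_sum_prod:
  fixes c :: "'k \<Rightarrow> 'a::comm_ring_1"
  shows "(\<Sum>k\<in>S. c k * (\<Prod>i\<in>I. f k i))\<^sup>2 = (\<Sum>k\<in>S. \<Sum>l\<in>S. c k * c l * (\<Prod>i\<in>I. f k i * f l i))"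
  by (simp add: power2_eq_square sum_product prod.distrib mult_ac)

text \<open>Every term of the expanded square is a product over coordinates and integrates factor by
  factor. Used forwards it evaluates the squared standard discrepancy; used backwards it shows that
  products of Gram kernels give nonnegative forms.\<close>

lemma has_bochner_integral_unit_cube_square:
  fixes a :: "'k \<Rightarrow> 'd::finite \<Rightarrow> real \<Rightarrow> real"
  assumes [measurable]: "\<And>k i. a k i \<in> borel_measurable borel"
    and bounded: "\<And>k i x. x \<in> {0..1} \<Longrightarrow> \<bar>a k i x\<bar> \<le> C"
  shows "has_bochner_integral unit_cube (\<lambda>t::real ^ 'd. (\<Sum>k\<in>S. c k * (\<Prod>i\<in>UNIV. a k i (t $ i)))\<^sup>2)
    (\<Sum>k\<in>S. \<Sum>l\<in>S. c k * c l * (\<Prod>i\<in>UNIV. \<integral>x. a k i x * a l i x \<partial>unit_interval))"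
  unfolding square_sum_prod
proof (intro has_bochner_integral_sum has_bochner_integral_mult_right has_bochner_integral_unit_cube_prod)
  fix k l i
  have "0 \<le> C"
    using bounded[of 0] by (meson abs_ge_zero atLeastAtMost_iff order_refl order_trans zero_le_one)
  show "integrable unit_interval (\<lambda>x. a k i x * a l i x)"
  proof (rule integrable_unit_interval_bounded)
    show "\<bar>a k i x * a l i x\<bar> \<le> C * C" if "x \<in> {0..1}" for x
      unfolding abs_mult using bounded that \<open>0 \<le> C\<close> by (intro mult_mono) auto
  qed measurable
qed

lemma gram_quadratic_form_nonneg:
  fixes a :: "'k \<Rightarrow> 'd::finite \<Rightarrow> real \<Rightarrow> real" and c :: "'k \<Rightarrow> real"
  assumes "\<And>k i. a k i \<in> borel_measurable borel"
    and "\<And>k i x. x \<in> {0..1} \<Longrightarrow> \<bar>a k i x\<bar> \<le> C"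
  shows "0 \<le> (\<Sum>k\<in>S. \<Sum>l\<in>S. c k * c l * (\<Prod>i\<in>UNIV. \<integral>x. a k i x * a l i x \<partial>unit_interval))"
proof -
  have "(\<Sum>k\<in>S. \<Sum>l\<in>S. c k * c l * (\<Prod>i\<in>UNIV. \<integral>x. a k i x * a l i x \<partial>unit_interval))
    = (\<integral>t. (\<Sum>k\<in>S. c k * (\<Prod>i\<in>UNIV. a k i (t $ i)))\<^sup>2 \<partial>(unit_cube :: (real ^ 'd) measure))"
    by (rule has_bochner_integral_integral_eq[symmetric], rule has_bochner_integral_unit_cube_square) (fact assms)+
  also have "\<dots> \<ge> 0"
    by (rule Bochner_Integration.integral_nonneg) simp
  finally show ?thesis .
qed

lemma covariance_quadratic_form_le:
  fixes a :: "'k \<Rightarrow> 'd::finite \<Rightarrow> real \<Rightarrow> real" and c :: "'k \<Rightarrow> real"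
  assumes [measurable]: "\<And>k i. a k i \<in> borel_measurable borel"
    and bounded: "\<And>k i x. x \<in> {0..1} \<Longrightarrow> \<bar>a k i x\<bar> \<le> C"
  shows "(\<Sum>k\<in>S. \<Sum>l\<in>S. c k * c l * (\<Prod>i\<in>UNIV. (\<integral>x. a k i x * a l i x \<partial>unit_interval)
        - (\<integral>x. a k i x \<partial>unit_interval) * (\<integral>x. a l i x \<partial>unit_interval)))
    \<le> (\<Sum>k\<in>S. \<Sum>l\<in>S. c k * c l * (\<Prod>i\<in>UNIV. \<integral>x. a k i x * a l i x \<partial>unit_interval))"
proof -
  interpret U: prob_space unit_interval
    by (rule prob_space_unit_interval)
  define m where "m k i = (\<integral>x. a k i x \<partial>unit_interval)" for k i
  define v where "v k l i = (\<integral>x. a k i x * a l i x \<partial>unit_interval) - m k i * m l i" for k l i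
  \<comment> \<open>\<open>Q X\<close> is the share of the subset \<open>X\<close> when the product
    of \<open>v k l i + m k i * m l i\<close> is expanded: the covariance is chosen at the
    coordinates in \<open>X\<close>, the product of means at the others.\<close>
  define Q where "Q X = (\<Sum>k\<in>S. \<Sum>l\<in>S. c k * c l * ((\<Prod>i\<in>X. v k l i) * (\<Prod>i\<in>UNIV - X. m k i * m l i)))" for X
  have C: "0 \<le> C"
    using bounded[of 0] by (meson abs_ge_zero atLeastAtMost_iff order_refl order_trans zero_le_one)
  have a: "integrable unit_interval (a k i)" for k i
    using bounded by (intro integrable_unit_interval_bounded[of _ C]) auto
  have aa: "integrable unit_interval (\<lambda>x. a k i x * a l i x)" for k l i
  proof (rule integrable_unit_interval_bounded)
    show "\<bar>a k i x * a l i x\<bar> \<le> C * C" if "x \<in> {0..1}" for x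
      unfolding abs_mult using bounded that C by (intro mult_mono) auto
  qed measurable
  have m: "\<bar>m k i\<bar> \<le> C" for k i
  proof -
    have "\<bar>m k i\<bar> \<le> (\<integral>x. \<bar>a k i x\<bar> \<partial>unit_interval)"
      unfolding m_def by (rule integral_abs_bound)
    also have "\<dots> \<le> (\<integral>x. C \<partial>unit_interval)"
      using a bounded by (intro integral_mono) (auto simp: space_restrict_space)
    finally show ?thesis
      by simp
  qed
  have Q_nonneg: "0 \<le> Q X" for X
  proof -
    \<comment> \<open>Centred functions have the covariance as their Gram kernel, and the constants
      \<open>m k i\<close> have the product of means. So \<open>Q X\<close> is the form of a product
      of Gram kernels; centring at most doubles the bound \<open>C\<close>.\<close>
    define b where "b k i x = (if i \<in> X then a k i x - m k i else m k i)" for k i x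
    have "\<bar>b k i x\<bar> \<le> 2 * C" if "x \<in> {0..1}" for k i x
      using bounded[OF that, of k i] m[of k i] C by (auto simp: b_def)
    moreover have "b k i \<in> borel_measurable borel" for k i
      unfolding b_def by measurable
    ultimately have "0 \<le> (\<Sum>k\<in>S. \<Sum>l\<in>S. c k * c l * (\<Prod>i\<in>UNIV. \<integral>x. b k i x * b l i x \<partial>unit_interval))"
      by (rule gram_quadratic_form_nonneg[rotated])
    moreover have "(\<integral>x. b k i x * b l i x \<partial>unit_interval) = (if i \<in> X then v k l i else m k i * m l i)" for k l i
    proof (cases "i \<in> X")
      case True
      have "b k i x * b l i x = a k i x * a l i x - m l i * a k i x - m k i * a l i x + m k i * m l i" for x
        using True by (simp add: b_def algebra_simps)
      then show ?thesis
        using True a aa by (simp add: v_def m_def[symmetric])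
    next
      case False
      then show ?thesis
        by (simp add: b_def U.prob_space)
    qed
    moreover have "(\<Prod>i\<in>UNIV. if i \<in> X then v k l i else m k i * m l i) =
      (\<Prod>i\<in>X. v k l i) * (\<Prod>i\<in>UNIV - X. m k i * m l i)" for k l
      by (simp add: prod.If_cases Compl_eq_Diff_UNIV)
    ultimately show ?thesis
      by (simp add: Q_def)
  qed
  have "(\<Sum>k\<in>S. \<Sum>l\<in>S. c k * c l * (\<Prod>i\<in>UNIV. v k l i)) = Q UNIV"
    by (simp add: Q_def)
  \<comment> \<open>The covariance form is the term for the full set of coordinates; adding the
    other nonnegative terms completes the expansion.\<close>
  also have "\<dots> \<le> (\<Sum>X\<in>Pow UNIV. Q X)"
    using Q_nonneg by (intro member_le_sum) auto
  also have "\<dots> = (\<Sum>k\<in>S. \<Sum>l\<in>S. \<Sum>X\<in>Pow UNIV. c k * c l * ((\<Prod>i\<in>X. v k l i) * (\<Prod>i\<in>UNIV - X. m k i * m l i)))"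
    unfolding Q_def by (subst sum.swap, intro sum.cong refl sum.swap)
  also have "\<dots> = (\<Sum>k\<in>S. \<Sum>l\<in>S. c k * c l * (\<Prod>i\<in>UNIV. v k l i + m k i * m l i))"
    by (simp only: prod_add[OF finite_class.finite_UNIV] sum_distrib_left)
  finally show ?thesis
    by (simp add: v_def m_def)
qed

text \<open>The order on vectors is componentwise, so the restriction to x \<le> y splits into one
  restriction per coordinate. The integrals over \<open>x\<close> and then over \<open>y\<close>
  therefore both factor, leaving a one-dimensional covariance in each coordinate.\<close>

lemma integral_unit_cube_increment_square:
  fixes a :: "'k \<Rightarrow> 'd::finite \<Rightarrow> real \<Rightarrow> real" and c :: "'k \<Rightarrow> real"
  assumes meas: "\<And>k i. a k i \<in> borel_measurable borel"
    and bounded: "\<And>k i x. x \<in> {0..1} \<Longrightarrow> \<bar>a k i x\<bar> \<le> C"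
  shows "(\<integral>y. (\<integral>x. (if x \<le> y then (\<Sum>k\<in>S. c k * (\<Prod>i\<in>UNIV. a k i (y $ i) - a k i (x $ i)))\<^sup>2 else 0) \<partial>unit_cube) \<partial>(unit_cube :: (real ^ 'd) measure))
    = (\<Sum>k\<in>S. \<Sum>l\<in>S. c k * c l * (\<Prod>i\<in>UNIV. (\<integral>x. a k i x * a l i x \<partial>unit_interval)
        - (\<integral>x. a k i x \<partial>unit_interval) * (\<integral>x. a l i x \<partial>unit_interval)))"
proof -
  define F where "F k l i y x = (if x \<le> y then (a k i y - a k i x) * (a l i y - a l i x) else 0)" for k l i x y
  have F_inner: "integrable unit_interval (F k l i y)" if "y \<in> {0..1}" for k l i y
    unfolding F_def using meas meas bounded bounded that by (rule covariance_eq_integral_increments(1))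
  have F_outer: "integrable unit_interval (\<lambda>y. \<integral>x. F k l i y x \<partial>unit_interval)" for k l i
    unfolding F_def using meas meas bounded bounded by (rule covariance_eq_integral_increments(2))
  have F_integral: "(\<integral>y. (\<integral>x. F k l i y x \<partial>unit_interval) \<partial>unit_interval) = (\<integral>x. a k i x * a l i x \<partial>unit_interval)
        - (\<integral>x. a k i x \<partial>unit_interval) * (\<integral>x. a l i x \<partial>unit_interval)" for k l i
    unfolding F_def using meas meas bounded bounded by (rule covariance_eq_integral_increments(3))
  have *: "(if x \<le> y then (\<Sum>k\<in>S. c k * (\<Prod>i\<in>UNIV. a k i (y $ i) - a k i (x $ i)))\<^sup>2 else 0)
    = (\<Sum>k\<in>S. \<Sum>l\<in>S. c k * c l * (\<Prod>i\<in>UNIV. F k l i (y $ i) (x $ i)))" for x y :: "real ^ 'd"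
  proof (cases "x \<le> y")
    case True
    then show ?thesis
      by (simp add: square_sum_prod F_def less_eq_vec_def)
  next
    case False
    \<comment> \<open>One violated coordinate makes its factor \<open>F\<close> zero and hence every
      product, matching the value 0 outside the ordered pairs.\<close>
    then obtain i where "\<not> x $ i \<le> y $ i"
      by (auto simp: less_eq_vec_def)
    then have "(\<Prod>i\<in>UNIV. F k l i (y $ i) (x $ i)) = 0" for k l
      by (intro prod_zero) (auto simp: F_def)
    with False show ?thesis
      by (simp only: if_False mult_zero_right sum.neutral_const)
  qed
  \<comment> \<open>Restricting \<open>y\<close> to the cube places each \<open>y $ i\<close> in
    [0,1], where \<open>F_inner\<close> gives integrability.\<close>
  have inner: "(\<integral>x. (\<Sum>k\<in>S. \<Sum>l\<in>S. c k * c l * (\<Prod>i\<in>UNIV. F k l i (y $ i) (x $ i))) \<partial>unit_cube)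
    = (\<Sum>k\<in>S. \<Sum>l\<in>S. c k * c l * (\<Prod>i\<in>UNIV. \<integral>x. F k l i (y $ i) x \<partial>unit_interval))"
    if "y \<in> cbox 0 1" for y :: "real ^ 'd"
    using that
    by (intro has_bochner_integral_integral_eq has_bochner_integral_sum has_bochner_integral_mult_right
        has_bochner_integral_unit_cube_prod F_inner) (auto simp: mem_box_cart)
  have "(\<integral>y. (\<integral>x. (\<Sum>k\<in>S. \<Sum>l\<in>S. c k * c l * (\<Prod>i\<in>UNIV. F k l i (y $ i) (x $ i))) \<partial>unit_cube) \<partial>(unit_cube :: (real ^ 'd) measure))
    = (\<integral>y. (\<Sum>k\<in>S. \<Sum>l\<in>S. c k * c l * (\<Prod>i\<in>UNIV. \<integral>x. F k l i (y $ i) x \<partial>unit_interval)) \<partial>(unit_cube :: (real ^ 'd) measure))"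
    using inner by (intro Bochner_Integration.integral_cong) (auto simp: space_restrict_space)
  also have "\<dots> = (\<Sum>k\<in>S. \<Sum>l\<in>S. c k * c l * (\<Prod>i\<in>UNIV. \<integral>y. (\<integral>x. F k l i y x \<partial>unit_interval) \<partial>unit_interval))"
    by (intro has_bochner_integral_integral_eq has_bochner_integral_sum has_bochner_integral_mult_right
        has_bochner_integral_unit_cube_prod F_outer)
  finally show ?thesis
    unfolding * F_integral .
qed

section \<open>The local discrepancy as a sum of products\<close>

lemma measure_lborel_half_open_box:
  fixes x y :: "real ^ 'd"
  assumes "x \<le> y"
  shows "measure lborel (half_open_box x y) = (\<Prod>i\<in>UNIV. y $ i - x $ i)"
proof -
  have le: "x $ i \<le> y $ i" for i
    using assms by (simp add: less_eq_vec_def)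
  have ind: "(\<Prod>i\<in>UNIV. indicator {x $ i..<y $ i} (z $ i)) = (indicator (half_open_box x y) z :: real)" for z
    by (auto simp: indicator_def half_open_box_def prod_zero_iff)
  have "has_bochner_integral lborel (\<lambda>z::real ^ 'd. \<Prod>i\<in>UNIV. indicat_real {x $ i..<y $ i} (z $ i))
      (\<Prod>i\<in>UNIV. \<integral>z. indicat_real {x $ i..<y $ i} z \<partial>lborel)"
    by (rule has_bochner_integral_lborel_prod[of "\<lambda>i. indicator {x $ i..<y $ i}"]) (simp add: le)
  then show ?thesis
    using le by (simp add: ind has_bochner_integral_iff)
qed

text \<open>\<open>None\<close> indexes the volume term, with weight -N and the identity as
  coordinate function; \<open>Some p\<close> indexes a point, with weight 1 and a step function. The
  strict step \<open>p $ i < t\<close> makes the increment from \<open>x\<close> to \<open>y\<close>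
  the indicator of the half-open interval in that coordinate.\<close>

lemma discrepancy_eq_sum_prod_increments:
  fixes P :: "(real ^ 'd) set" and x y :: "real ^ 'd" and N :: nat
  assumes P: "finite P" and xy: "x \<le> y"
  defines "c \<equiv> \<lambda>k. case k of None \<Rightarrow> - real N | Some p \<Rightarrow> 1"
    and "a \<equiv> \<lambda>k i t. case k of None \<Rightarrow> t | Some p \<Rightarrow> if p $ i < t then 1 else 0"
  shows "real (point_count (half_open_box x y) P) - real N * measure lborel (half_open_box x y)
    = (\<Sum>k\<in>insert None (Some ` P). c k * (\<Prod>i\<in>UNIV. a k i (y $ i) - a k i (x $ i)))"
proof -
  have le: "x $ i \<le> y $ i" for i
    using xy by (simp add: less_eq_vec_def)
  have a: "a (Some p) i (y $ i) - a (Some p) i (x $ i) = (if x $ i \<le> p $ i \<and> p $ i < y $ i then 1 else 0)" for p i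
    using le[of i] by (auto simp: a_def)
  have "(\<Prod>i\<in>UNIV. a (Some p) i (y $ i) - a (Some p) i (x $ i)) = indicator (half_open_box x y) p" for p
    unfolding a by (auto simp: indicator_def half_open_box_def prod_zero_iff)
  then have "(\<Sum>k\<in>Some ` P. c k * (\<Prod>i\<in>UNIV. a k i (y $ i) - a k i (x $ i))) = (\<Sum>p\<in>P. indicator (half_open_box x y) p)"
    by (simp add: sum.reindex c_def)
  also have "\<dots> = real (point_count (half_open_box x y) P)"
    using P by (simp add: point_count_def sum.If_cases indicator_def Int_def)
  finally show ?thesis
    using P by (simp add: measure_lborel_half_open_box[OF xy] c_def a_def)
qed

theorem theorem5:
  fixes P :: "(real ^ 'd) set" and N :: nat
  assumes "N \<ge> 1"
    and "card P = N"
    and "P \<subseteq> half_open_box 0 1"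
  shows "extreme_L2_discrepancy N P \<le> L2_discrepancy N P"
proof -
  have P: "finite P"
    using assms by (metis card.infinite not_one_le_zero)
  define S where "S = insert None (Some ` P)"
  define c where "c = (\<lambda>k::(real ^ 'd) option. case k of None \<Rightarrow> - real N | Some p \<Rightarrow> 1)"
  define a where "a = (\<lambda>(k::(real ^ 'd) option) i t::real. case k of None \<Rightarrow> t | Some p \<Rightarrow> if p $ i < t then 1 else 0)"
  define D where "D x y = real (point_count (half_open_box x y) P) - real N * measure lborel (half_open_box x y)"
    for x y :: "real ^ 'd"
  have D: "D x y = (\<Sum>k\<in>S. c k * (\<Prod>i\<in>UNIV. a k i (y $ i) - a k i (x $ i)))" if "x \<le> y" for x y
    unfolding D_def S_def c_def a_def using P that by (rule discrepancy_eq_sum_prod_increments)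
  have meas: "a k i \<in> borel_measurable borel" for k i
    by (cases k) (simp_all add: a_def)
  have bounded: "\<bar>a k i t\<bar> \<le> 1" if "t \<in> {0..1}" for k i t
    using that by (cases k) (auto simp: a_def)
  \<comment> \<open>Points of \<open>P\<close> have nonnegative coordinates, so no step has occurred
    at 0. For boxes anchored at 0 the increments thus reduce to the values
    \<open>a k i (t $ i)\<close>.\<close>
  have a0: "a k i 0 = 0" if "k \<in> S" for k i
    using that assms(3) by (auto simp: a_def S_def half_open_box_def not_less)
  have std: "(LINT t:cbox 0 1|lborel. \<bar>D 0 t\<bar>\<^sup>2)
    = (\<Sum>k\<in>S. \<Sum>l\<in>S. c k * c l * (\<Prod>i\<in>UNIV. \<integral>x. a k i x * a l i x \<partial>unit_interval))"
  proof -
    have "(LINT t:cbox 0 1|lborel. \<bar>D 0 t\<bar>\<^sup>2) = (\<integral>t. \<bar>D 0 t\<bar>\<^sup>2 \<partial>unit_cube)"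
      by (simp add: set_lebesgue_integral_def integral_restrict_space)
    also have "\<dots> = (\<integral>t. (\<Sum>k\<in>S. c k * (\<Prod>i\<in>UNIV. a k i (t $ i)))\<^sup>2 \<partial>unit_cube)"
      by (intro Bochner_Integration.integral_cong refl)
        (simp add: D a0 space_restrict_space mem_box_cart less_eq_vec_def)
    also have "\<dots> = (\<Sum>k\<in>S. \<Sum>l\<in>S. c k * c l * (\<Prod>i\<in>UNIV. \<integral>x. a k i x * a l i x \<partial>unit_interval))"
      using meas bounded by (intro has_bochner_integral_integral_eq has_bochner_integral_unit_cube_square)
    finally show ?thesis .
  qed
  \<comment> \<open>The condition x \<le> y moves from the domain into the integrand, so that both
    integrals run over the unit cube.\<close>
  have "(LINT y:cbox 0 1|lborel. (LINT x:{x \<in> cbox 0 1. x \<le> y}|lborel. \<bar>D x y\<bar>\<^sup>2))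
    = (\<integral>y. (\<integral>x. (if x \<le> y then \<bar>D x y\<bar>\<^sup>2 else 0) \<partial>unit_cube) \<partial>unit_cube)"
    by (auto simp: set_lebesgue_integral_def integral_restrict_space indicator_def
        intro!: Bochner_Integration.integral_cong)
  also have "\<dots> = (\<integral>y. (\<integral>x. (if x \<le> y then (\<Sum>k\<in>S. c k * (\<Prod>i\<in>UNIV. a k i (y $ i) - a k i (x $ i)))\<^sup>2 else 0)
      \<partial>unit_cube) \<partial>unit_cube)"
    by (intro Bochner_Integration.integral_cong refl) (simp add: D)
  also have "\<dots> = (\<Sum>k\<in>S. \<Sum>l\<in>S. c k * c l * (\<Prod>i\<in>UNIV. (\<integral>x. a k i x * a l i x \<partial>unit_interval)
        - (\<integral>x. a k i x \<partial>unit_interval) * (\<integral>x. a l i x \<partial>unit_interval)))"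
    using meas bounded by (rule integral_unit_cube_increment_square)
  also have "\<dots> \<le> (LINT t:cbox 0 1|lborel. \<bar>D 0 t\<bar>\<^sup>2)"
    unfolding std using meas bounded by (rule covariance_quadratic_form_le)
  finally show ?thesis
    unfolding extreme_L2_discrepancy_def L2_discrepancy_def D_def by simp
qed

end
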